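(* Let $K\in\mathbb{R}^{n\times n}$ be symmetric with $0\preceq K\preceq I$, and let $\mathcal{X}$ be the determinantal point process with marginal kernel $K$. Let $p\ge 0$ be the multiplicity of $1$ as an eigenvalue of $K$, let $V\in\mathbb{R}^{n\times p}$ be the matrix whose columns are $p$ orthonormal eigenvectors of $K$ associated with the eigenvalue $1$, and let $L=K(I-K)^{\dagger}$, where $\dagger$ denotes the Moore–Penrose pseudo-inverse. Then $(L;V)$ is a nonnegative pair and $\mathcal{X}$ is an extended L-ensemble based on $(L;V)$.
   Context: All matrices are real. The ground set is $\Omega$, identified with $\{1,\dots,n\}$; a point process is a random subset $\mathcal{X}\subseteq\Omega$. For a matrix $A$ and index sets $X,Y$, $A_{X,Y}$ is the submatrix with rows in $X$ and columns in $Y$, $A_X=A_{X,X}$, and $A_{X,:}$ keeps the rows in $X$ and all columns. The determinant of an empty matrix is $1$. Determinantal point process (DPP): for a symmetric $K\in\mathbb{R}^{n\times n}$ with $0\preceq K\preceq I$, $\mathcal{X}$ is a DPP with marginal kernel $K$ if $\mathbf{P}(A\subseteq\mathcal{X})=\det K_A$ for all $A\subseteq\Omega$. Nonnegative pair (NNP): a pair $(L;V)$ with $L\in\mathbb{R}^{n\times n}$ symmetric, $V\in\mathbb{R}^{n\times p}$, $0\le p\le n$, $V$ of full column rank, and $L$ conditionally positive semi-definite with respect to $V$, i.e. $x^\top Lx\ge 0$ for all $x\in\mathbb{R}^n$ with $V^\top x=0$. (The case $p=0$ is allowed: then $L$ is positive semi-definite.) Extended L-ensemble based on the NNP $(L;V)$: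 a point process $\mathcal{X}$ such that, for all $X\subseteq\Omega$, $$\mathbf{P}(\mathcal{X}=X)\propto(-1)^p\det\begin{pmatrix}L_X&V_{X,:}\\(V_{X,:})^\top&0\end{pmatrix}.$$ *)

theory Defs
  imports
    "HOL-Probability.Probability_Measure"
    "Jordan_Normal_Form.Char_Poly"
    "Jordan_Normal_Form.DL_Rank"
    "Jordan_Normal_Form.DL_Submatrix"
begin

text \<open>
  The ground set is \<open>{..<n}\<close>, since matrix indices start at 0. The names \<open>det\<close>, \<open>order\<close> and
  \<open>rank\<close> occur in several libraries and are therefore qualified: determinants are those of
  \<^const>\<open>Determinant.det\<close>, for which the empty matrix has determinant 1.
\<close>

definition symmetric_matrix :: "nat \<Rightarrow> real mat \<Rightarrow> bool" where
  "symmetric_matrix n A \<longleftrightarrow> A \<in> carrier_mat n n \<and> transpose_mat A = A"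

definition psd_matrix :: "nat \<Rightarrow> real mat \<Rightarrow> bool" where
  "psd_matrix n A \<longleftrightarrow>
     symmetric_matrix n A \<and> (\<forall>x \<in> carrier_vec n. scalar_prod x (A *\<^sub>v x) \<ge> 0)"

definition loewner_le :: "nat \<Rightarrow> real mat \<Rightarrow> real mat \<Rightarrow> bool" where
  "loewner_le n A B \<longleftrightarrow> psd_matrix n (B - A)"

definition is_moore_penrose :: "real mat \<Rightarrow> real mat \<Rightarrow> bool" where
  "is_moore_penrose A B \<longleftrightarrow>
     B \<in> carrier_mat (dim_col A) (dim_row A) \<and>
     A * B * A = A \<and>
     B * A * B = B \<and>
     transpose_mat (A * B) = A * B \<and>
     transpose_mat (B * A) = B * A"

lemma is_moore_penrose_unique:
  assumes B: "is_moore_penrose A B" and C: "is_moore_penrose A C"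
  shows "B = C"
proof -
  obtain m n where A: "A \<in> carrier_mat m n" by blast
  have cB: "B \<in> carrier_mat n m" and cC: "C \<in> carrier_mat n m"
    using A B C by (auto simp: is_moore_penrose_def)
  note c = A cB cC
  have B1: "A * B * A = A" and B2: "B * A * B = B"
    and B3: "transpose_mat (A * B) = A * B" and B4: "transpose_mat (B * A) = B * A"
    using B by (auto simp: is_moore_penrose_def)
  have C1: "A * C * A = A" and C2: "C * A * C = C"
    and C3: "transpose_mat (A * C) = A * C" and C4: "transpose_mat (C * A) = C * A"
    using C by (auto simp: is_moore_penrose_def)
  have AB: "A * B \<in> carrier_mat m m" and AC: "A * C \<in> carrier_mat m m"
    and BA: "B * A \<in> carrier_mat n n" and CA: "C * A \<in> carrier_mat n n"
    using c by auto
  have l: "A * B = A * C"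
  proof -
    have "A * B = (A * C) * (A * B)"
      using C1 assoc_mult_mat[OF AC A cB] by simp
    then have "transpose_mat (A * B) = transpose_mat (A * B) * transpose_mat (A * C)"
      using transpose_mult[OF AC AB] by simp
    then have "A * B = (A * B) * (A * C)" using B3 C3 by simp
    also have "\<dots> = A * C"
      using B1 assoc_mult_mat[OF AB A cC] by simp
    finally show ?thesis .
  qed
  have r: "B * A = C * A"
  proof -
    have "B * A = (B * A) * (C * A)"
      using C1 assoc_mult_mat[OF cB A CA] assoc_mult_mat[OF A cC A] by simp
    then have "transpose_mat (B * A) = transpose_mat (C * A) * transpose_mat (B * A)"
      using transpose_mult[OF BA CA] by simp
    then have "B * A = (C * A) * (B * A)" using B4 C4 by simp
    also have "\<dots> = C * A"
      using B1 assoc_mult_mat[OF cC A BA] assoc_mult_mat[OF A cB A] by simp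
    finally show ?thesis .
  qed
  have "B = C * A * B" using B2 r by simp
  also have "\<dots> = C * (A * C)" using assoc_mult_mat[OF cC A cB] l by simp
  also have "\<dots> = C" using C2 assoc_mult_mat[OF cC A cC] by simp
  finally show ?thesis .
qed

definition moore_penrose :: "real mat \<Rightarrow> real mat" where
  "moore_penrose A = (THE B. is_moore_penrose A B)"

definition point_process :: "nat \<Rightarrow> 'a measure \<Rightarrow> ('a \<Rightarrow> nat set) \<Rightarrow> bool" where
  "point_process n M X \<longleftrightarrow>
     prob_space M \<and> X \<in> measurable M (count_space (Pow {..<n}))"

definition is_dpp :: "nat \<Rightarrow> real mat \<Rightarrow> 'a measure \<Rightarrow> ('a \<Rightarrow> nat set) \<Rightarrow> bool" where
  "is_dpp n K M X \<longleftrightarrow>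
     symmetric_matrix n K \<and> loewner_le n (0\<^sub>m n n) K \<and> loewner_le n K (1\<^sub>m n) \<and>
     point_process n M X \<and>
     (\<forall>A \<subseteq> {..<n}.
        measure M {\<omega> \<in> space M. A \<subseteq> X \<omega>} = Determinant.det (submatrix K A A))"

definition cond_psd :: "nat \<Rightarrow> nat \<Rightarrow> real mat \<Rightarrow> real mat \<Rightarrow> bool" where
  "cond_psd n p L V \<longleftrightarrow>
     (\<forall>x \<in> carrier_vec n. transpose_mat V *\<^sub>v x = 0\<^sub>v p \<longrightarrow> scalar_prod x (L *\<^sub>v x) \<ge> 0)"

definition nonneg_pair :: "nat \<Rightarrow> nat \<Rightarrow> real mat \<Rightarrow> real mat \<Rightarrow> bool" where
  "nonneg_pair n p L V \<longleftrightarrow>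
     symmetric_matrix n L \<and> V \<in> carrier_mat n p \<and> p \<le> n \<and>
     vec_space.rank n V = p \<and> cond_psd n p L V"

definition bordered_matrix :: "nat \<Rightarrow> real mat \<Rightarrow> real mat \<Rightarrow> nat set \<Rightarrow> real mat" where
  "bordered_matrix p L V S =
     four_block_mat (submatrix L S S) (submatrix V S UNIV)
                    (transpose_mat (submatrix V S UNIV)) (0\<^sub>m p p)"

text \<open>Proportionality means equality up to a positive constant that does not depend on the set.\<close>

definition is_extended_L_ensemble ::
  "nat \<Rightarrow> nat \<Rightarrow> real mat \<Rightarrow> real mat \<Rightarrow> 'a measure \<Rightarrow> ('a \<Rightarrow> nat set) \<Rightarrow> bool" where
  "is_extended_L_ensemble n p L V M X \<longleftrightarrow>
     nonneg_pair n p L V \<and> point_process n M X \<and>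
     (\<exists>c > 0. \<forall>S \<subseteq> {..<n}.
        measure M {\<omega> \<in> space M. X \<omega> = S} =
          c * ((- 1) ^ p * Determinant.det (bordered_matrix p L V S)))"

end

theory Submission
  imports Defs
begin

text \<open>
  Let \<open>P = V V\<^sup>T\<close> be the projection onto the eigenspace of \<open>1\<close> and split \<open>K = K1 + P\<close>, so that
  \<open>K1 P = 0\<close>. The matrix \<open>M = I - K1 = (I - K) + P\<close> is symmetric, acts as \<open>I - K\<close> off the eigenspace
  and as the identity on it. Everything reduces to its inverse: \<open>(I - K)\<^sup>\<dagger> = M\<^sup>-\<^sup>1 - P\<close> and hence
  \<open>L = M\<^sup>-\<^sup>1 - I\<close>.

  Invertibility of \<open>M\<close> is where the multiplicity \<open>p\<close> enters (\<open>det_M_nonzero\<close>): the factorisation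
  \<open>(x I - K1) (x I - P) = x (x I - K)\<close> and Sylvester's identity for \<open>det (x I - P)\<close> show that the \<open>p\<close>
  columns of \<open>V\<close> use up the whole order of vanishing of the characteristic polynomial of \<open>K\<close> at
  \<open>1\<close>. Since \<open>M\<close> is also positive semidefinite, \<open>det M > 0\<close>. Conditional positivity of \<open>L\<close> follows
  from the substitution \<open>y = M\<^sup>-\<^sup>1 x\<close>, which turns \<open>x\<^sup>T L x\<close> into \<open>y\<^sup>T (I - K) K y\<close>.

  For the distribution, let \<open>R\<close> be the matrix whose rows in \<open>S\<close> are those of \<open>K\<close> and whose other rows
  are those of \<open>I - K\<close>. Inclusion-exclusion gives \<open>P(X = S) = det R\<close>
  (\<open>dpp_point_probability\<close>). On the other side, a block factorisation shows
  \<open>det B \<cdot> det M = (-1)\<^sup>p det R\<close> for the bordered matrix \<open>B\<close> of \<open>S\<close> (\<open>det_bordered\<close>), so \<open>det M\<close> is the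
  constant of proportionality. To compare these determinants for different \<open>S\<close>, principal minors are
  first rewritten as determinants of full size in which the rows outside \<open>S\<close> are replaced by unit
  rows (\<open>det_principal_minor\<close>).
\<close>

section \<open>Elementary matrix identities and row selection\<close>

lemma minus_zero_mat [simp]:
  fixes A :: "'a::group_add mat"
  shows "A \<in> carrier_mat m k \<Longrightarrow> A - 0\<^sub>m m k = A"
  by (intro eq_matI) auto

lemma one_smult_mat [simp]:
  fixes A :: "'a::monoid_mult mat"
  shows "1 \<cdot>\<^sub>m A = A"
  by (intro eq_matI) auto

definition choose_rows :: "nat set \<Rightarrow> 'a mat \<Rightarrow> 'a mat \<Rightarrow> 'a mat" where
  "choose_rows S A B =
     Matrix.mat (dim_row A) (dim_col A) (\<lambda>(i, j). if i \<in> S then A $$ (i, j) else B $$ (i, j))"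

lemma choose_rows_carrier [simp]:
  "A \<in> carrier_mat m k \<Longrightarrow> choose_rows S A B \<in> carrier_mat m k"
  by (auto simp: choose_rows_def)

lemma dim_choose_rows [simp]:
  "dim_row (choose_rows S A B) = dim_row A" "dim_col (choose_rows S A B) = dim_col A"
  by (simp_all add: choose_rows_def)

lemma choose_rows_index [simp]:
  "i < dim_row A \<Longrightarrow> j < dim_col A \<Longrightarrow>
   choose_rows S A B $$ (i, j) = (if i \<in> S then A $$ (i, j) else B $$ (i, j))"
  by (simp add: choose_rows_def)

lemma choose_rows_mult:
  assumes A: "A \<in> carrier_mat m k" and B: "B \<in> carrier_mat m k" and C: "C \<in> carrier_mat k l"
  shows "choose_rows S A B * C = choose_rows S (A * C) (B * C)"
proof (rule eq_matI)
  fix i j assume "i < dim_row (choose_rows S (A * C) (B * C))"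
    and "j < dim_col (choose_rows S (A * C) (B * C))"
  then have i: "i < m" and j: "j < l" using A C by auto
  have "Matrix.row (choose_rows S A B) i = (if i \<in> S then Matrix.row A i else Matrix.row B i)"
    using A B i by (intro eq_vecI) auto
  then show "(choose_rows S A B * C) $$ (i, j) = choose_rows S (A * C) (B * C) $$ (i, j)"
    using A B C i j by auto
qed (use A B C in auto)

lemma det_row_diff:
  fixes A B C :: "'a::comm_ring_1 mat"
  assumes A: "A \<in> carrier_mat n n" and B: "B \<in> carrier_mat n n" and C: "C \<in> carrier_mat n n"
    and t: "t < n"
    and diff: "\<And>j. j < n \<Longrightarrow> C $$ (t, j) = A $$ (t, j) - B $$ (t, j)"
    and AC: "\<And>i j. i < n \<Longrightarrow> j < n \<Longrightarrow> i \<noteq> t \<Longrightarrow> A $$ (i, j) = C $$ (i, j)"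
    and BC: "\<And>i j. i < n \<Longrightarrow> j < n \<Longrightarrow> i \<noteq> t \<Longrightarrow> B $$ (i, j) = C $$ (i, j)"
  shows "Determinant.det C = Determinant.det A - Determinant.det B"
proof -
  have del: "mat_delete M t j = mat_delete C t j"
    if M: "M \<in> carrier_mat n n" and j: "j < n"
      and MC: "\<And>i j. i < n \<Longrightarrow> j < n \<Longrightarrow> i \<noteq> t \<Longrightarrow> M $$ (i, j) = C $$ (i, j)" for M j
    unfolding mat_delete_def using M C t j by (intro eq_matI) (auto intro!: MC)
  have cof: "cofactor A t j = cofactor C t j" "cofactor B t j = cofactor C t j" if "j < n" for j
    unfolding cofactor_def using del[OF A that AC] del[OF B that BC] by auto
  have "Determinant.det C = (\<Sum>j<n. (A $$ (t, j) - B $$ (t, j)) * cofactor C t j)"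
    unfolding laplace_expansion_row[OF C t] by (intro sum.cong) (auto simp: diff)
  also have "\<dots> = (\<Sum>j<n. A $$ (t, j) * cofactor A t j) - (\<Sum>j<n. B $$ (t, j) * cofactor B t j)"
    unfolding sum_subtractf[symmetric] by (intro sum.cong) (auto simp: cof algebra_simps)
  also have "\<dots> = Determinant.det A - Determinant.det B"
    using laplace_expansion_row[OF A t] laplace_expansion_row[OF B t] by simp
  finally show ?thesis .
qed

section \<open>Principal minors as determinants of full size\<close>

text \<open>
  After a simultaneous permutation of rows and columns that brings the range of \<open>f\<close> to the front,
  the matrix on the right is block upper triangular, with diagonal blocks the matrix on the left
  and an identity matrix. The sign of the permutation enters twice and cancels.
\<close>

lemma det_principal_minor:
  fixes A :: "'a::idom mat"
  assumes A: "A \<in> carrier_mat m m" and inj: "inj_on f {..<k}" and im: "f ` {..<k} \<subseteq> {..<m}"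
  shows "Determinant.det (Matrix.mat k k (\<lambda>(i, j). A $$ (f i, f j))) =
         Determinant.det (choose_rows (f ` {..<k}) A (1\<^sub>m m))"
proof -
  have k: "k \<le> m" using card_inj_on_le[OF inj im] by simp
  have "card {k..<m} = card ({..<m} - f ` {..<k})"
    using im by (simp add: card_Diff_subset card_image[OF inj])
  then obtain g where g: "bij_betw g {k..<m} ({..<m} - f ` {..<k})"
    using finite_same_card_bij[of "{k..<m}" "{..<m} - f ` {..<k}"] by auto
  \<comment> \<open>Extend \<open>f\<close> to a permutation by enumerating the complement of its range with \<open>g\<close>.\<close>
  define h where "h i = (if i < k then f i else if i < m then g i else i)" for i
  have "bij_betw h {..<k} (f ` {..<k})"
    using inj by (auto simp: h_def bij_betw_def inj_on_def)
  moreover have "bij_betw h {k..<m} ({..<m} - f ` {..<k})"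
    using g by (rule bij_betw_cong[THEN iffD1, rotated]) (auto simp: h_def)
  ultimately have "bij_betw h ({..<k} \<union> {k..<m}) (f ` {..<k} \<union> ({..<m} - f ` {..<k}))"
    by (rule bij_betw_combine) auto
  moreover have "{..<k} \<union> {k..<m} = {0..<m}" "f ` {..<k} \<union> ({..<m} - f ` {..<k}) = {0..<m}"
    using k im by auto
  ultimately have bij: "bij_betw h {0..<m} {0..<m}" by simp
  have per: "h permutes {0..<m}"
    using bij by (rule bij_imp_permutes) (use k in \<open>auto simp: h_def\<close>)
  have hm: "h i < m" if "i < m" for i using bij_betwE[OF bij] that by auto
  have hinj: "h i = h j \<longleftrightarrow> i = j" if "i < m" "j < m" for i j
    using bij that by (auto simp: bij_betw_def inj_on_def)
  define C where "C = choose_rows (f ` {..<k}) A (1\<^sub>m m)"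
  have C: "C \<in> carrier_mat m m" using A by (simp add: C_def)
  define D where "D = Matrix.mat m m (\<lambda>(i, j). C $$ (h i, j))"
  have D: "D \<in> carrier_mat m m" by (simp add: D_def)
  have dD: "Determinant.det D = signof h * Determinant.det C"
    unfolding D_def using det_permute_rows[OF C per] .
  define E where "E = Matrix.mat m m (\<lambda>(i, j). D $$ (i, h j))"
  have E: "E \<in> carrier_mat m m" by (simp add: E_def)
  have "E\<^sup>T = Matrix.mat m m (\<lambda>(i, j). D\<^sup>T $$ (h i, j))"
    using D hm by (intro eq_matI) (auto simp: E_def)
  then have "Determinant.det (E\<^sup>T) = signof h * Determinant.det (D\<^sup>T)"
    using det_permute_rows[of "D\<^sup>T" m h] D per by simp
  then have dE: "Determinant.det E = Determinant.det C"
    using dD det_transpose[OF E] det_transpose[OF D] by (auto simp: sign_def)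
  define F where "F = Matrix.mat k k (\<lambda>(i, j). A $$ (f i, f j))"
  have hk: "h i = f i" if "i < k" for i using that by (simp add: h_def)
  have hout: "h i \<notin> f ` {..<k}" if "k \<le> i" "i < m" for i
    using bij_betwE[OF g] that by (auto simp: h_def)
  have "E = four_block_mat F (Matrix.mat k (m - k) (\<lambda>(i, j). A $$ (f i, h (k + j))))
              (0\<^sub>m (m - k) k) (1\<^sub>m (m - k))"
  proof (rule eq_matI, goal_cases)
    case (1 i j)
    then have i: "i < m" and j: "j < m" using k by (auto simp: F_def)
    have "E $$ (i, j) = (if h i \<in> f ` {..<k} then A $$ (h i, h j) else if h i = h j then 1 else 0)"
      using A i j hm[OF i] hm[OF j] by (simp add: E_def D_def C_def)
    moreover have "h i \<in> f ` {..<k} \<longleftrightarrow> i < k"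
      using hout[of i] i hk[of i] by (cases "i < k") auto
    ultimately show ?case
      using i j k hinj[OF i j] hk by (auto simp: F_def)
  qed (use k in \<open>auto simp: E_def F_def\<close>)
  then have "Determinant.det E = Determinant.det F"
    using det_four_block_mat_lower_left_zero[of F k
        "Matrix.mat k (m - k) (\<lambda>(i, j). A $$ (f i, h (k + j)))" "m - k" "0\<^sub>m (m - k) k" "1\<^sub>m (m - k)"]
    by (simp add: F_def)
  then show ?thesis using dE by (simp add: C_def F_def)
qed

lemma pick_inj_image:
  assumes "S \<subseteq> {..<n}"
  shows "inj_on (pick S) {..<card S}" and "pick S ` {..<card S} = S"
proof -
  have fin: "finite S" using assms finite_subset by blast
  have S: "{a. a < n \<and> a \<in> S} = S" using assms by auto
  show inj: "inj_on (pick S) {..<card S}"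
    by (intro inj_onI) (metis lessThan_iff nat_neq_iff pick_mono)
  have "pick S ` {..<card S} \<subseteq> S" using pick_in_set_le by auto
  then show "pick S ` {..<card S} = S"
    using card_image[OF inj] card_subset_eq[OF fin] by simp
qed

lemma det_submatrix:
  fixes A :: "'a::idom mat"
  assumes A: "A \<in> carrier_mat n n" and S: "S \<subseteq> {..<n}"
  shows "Determinant.det (submatrix A S S) = Determinant.det (choose_rows S A (1\<^sub>m n))"
proof -
  have "{i. i < n \<and> i \<in> S} = S" using S by auto
  then have "submatrix A S S = Matrix.mat (card S) (card S) (\<lambda>(i, j). A $$ (pick S i, pick S j))"
    using A by (simp add: submatrix_def)
  then show ?thesis
    using det_principal_minor[OF A pick_inj_image(1)[OF S]] pick_inj_image(2)[OF S] S by simp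
qed

text \<open>
  The bordered matrix is the principal submatrix of the full matrix with blocks \<open>L\<close>, \<open>V\<close>,
  \<open>V\<^sup>T\<close>, \<open>0\<close> on the indices in \<open>S\<close> and all \<open>p\<close> border indices.
\<close>

lemma det_bordered_matrix:
  assumes L: "L \<in> carrier_mat n n" and V: "V \<in> carrier_mat n p" and S: "S \<subseteq> {..<n}"
  shows "Determinant.det (bordered_matrix p L V S) =
         Determinant.det (four_block_mat (choose_rows S L (1\<^sub>m n)) (choose_rows S V (0\<^sub>m n p))
                            (V\<^sup>T) (0\<^sub>m p p))"
proof -
  define k where "k = card S"
  \<comment> \<open>Enumerate \<open>S\<close> in increasing order, followed by the border indices \<open>n, \<dots>, n + p - 1\<close>.\<close>
  define f where "f i = (if i < k then pick S i else n + (i - k))" for i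
  define A where "A = four_block_mat L V (V\<^sup>T) (0\<^sub>m p p)"
  have A: "A \<in> carrier_mat (n + p) (n + p)" using L V by (simp add: A_def)
  note inj = pick_inj_image(1)[OF S, folded k_def] and im = pick_inj_image(2)[OF S, folded k_def]
  have lt: "pick S i < n" if "i < k" for i using im S that by blast
  have finj: "inj_on f {..<k + p}"
  proof (rule inj_onI)
    fix i j assume "i \<in> {..<k + p}" "j \<in> {..<k + p}" "f i = f j"
    then show "i = j"
      using inj_onD[OF inj, of i j] lt[of i] lt[of j] by (auto simp: f_def split: if_splits)
  qed
  have fim: "f ` {..<k + p} = S \<union> {n..<n + p}"
  proof -
    have "f ` {..<k} = pick S ` {..<k}" by (intro image_cong) (auto simp: f_def)
    then have "f ` {..<k} = S" using im by simp
    moreover have "f ` {k..<k + p} = {n..<n + p}"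
    proof
      show "{n..<n + p} \<subseteq> f ` {k..<k + p}"
      proof
        fix x assume "x \<in> {n..<n + p}"
        then have "x = f (k + (x - n))" "k + (x - n) \<in> {k..<k + p}" by (auto simp: f_def)
        then show "x \<in> f ` {k..<k + p}" by blast
      qed
    qed (auto simp: f_def)
    moreover have "{..<k + p} = {..<k} \<union> {k..<k + p}" by auto
    ultimately show ?thesis by (metis image_Un)
  qed
  have cS: "{i. i < n \<and> i \<in> S} = S" using S by auto
  have "bordered_matrix p L V S = Matrix.mat (k + p) (k + p) (\<lambda>(i, j). A $$ (f i, f j))"
    using L V lt trans_less_add1[OF lt, of _ p]
    by (intro eq_matI)
      (auto simp: bordered_matrix_def submatrix_def cS k_def[symmetric] pick_UNIV A_def f_def)
  then have "Determinant.det (bordered_matrix p L V S) =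
      Determinant.det (choose_rows (S \<union> {n..<n + p}) A (1\<^sub>m (n + p)))"
    using det_principal_minor[OF A finj] fim S by (simp add: subset_iff trans_less_add1)
  also have "choose_rows (S \<union> {n..<n + p}) A (1\<^sub>m (n + p)) =
      four_block_mat (choose_rows S L (1\<^sub>m n)) (choose_rows S V (0\<^sub>m n p)) (V\<^sup>T) (0\<^sub>m p p)"
    using L V S by (intro eq_matI) (auto simp: A_def)
  finally show ?thesis .
qed

section \<open>The distribution of a determinantal process\<close>

text \<open>
  Inclusion-exclusion in determinantal form: forbidding one more point \<open>t\<close> subtracts the
  probability that \<open>t\<close> is present, and by linearity in row \<open>t\<close> this turns the unit row into the
  corresponding row of \<open>I - K\<close>.
\<close>

lemma dpp_inclusion_exclusion:
  assumes dpp: "is_dpp n K M X" and "T \<subseteq> {..<n}" and "A \<subseteq> {..<n}" and "A \<inter> T = {}"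
  shows "measure M {\<omega> \<in> space M. A \<subseteq> X \<omega> \<and> X \<omega> \<inter> T = {}} =
         Determinant.det (choose_rows A K (choose_rows T (1\<^sub>m n - K) (1\<^sub>m n)))"
proof -
  have K: "K \<in> carrier_mat n n" using dpp by (auto simp: is_dpp_def symmetric_matrix_def)
  interpret prob_space M using dpp by (auto simp: is_dpp_def point_process_def)
  have X: "X \<in> measurable M (count_space (Pow {..<n}))"
    using dpp by (auto simp: is_dpp_def point_process_def)
  have ev: "{\<omega> \<in> space M. Q (X \<omega>)} \<in> sets M" for Q
  proof -
    have "{\<omega> \<in> space M. Q (X \<omega>)} = X -` {Y \<in> Pow {..<n}. Q Y} \<inter> space M"
      using measurable_space[OF X] by auto
    then show ?thesis using measurable_sets[OF X, of "{Y \<in> Pow {..<n}. Q Y}"] by auto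
  qed
  have "finite T" using assms(2) finite_subset by blast
  then show ?thesis using assms(2-4)
  proof (induction T arbitrary: A)
    case empty
    have "choose_rows A K (choose_rows {} (1\<^sub>m n - K) (1\<^sub>m n)) = choose_rows A K (1\<^sub>m n)"
      using K by (intro eq_matI) auto
    then show ?case
      using dpp empty det_submatrix[OF K empty(2)] by (simp add: is_dpp_def)
  next
    case (insert t T)
    let ?E = "\<lambda>B U. {\<omega> \<in> space M. B \<subseteq> X \<omega> \<and> X \<omega> \<inter> U = {}}"
    let ?D = "\<lambda>B U. choose_rows B K (choose_rows U (1\<^sub>m n - K) (1\<^sub>m n))"
    have t: "t < n" "t \<notin> A" using insert.prems by auto
    have "?E A (insert t T) = ?E A T - ?E (insert t A) T" by auto
    then have "measure M (?E A (insert t T)) = measure M (?E A T) - measure M (?E (insert t A) T)"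
      using finite_measure_Diff[of "?E A T" "?E (insert t A) T"]
        ev[of "\<lambda>Y. A \<subseteq> Y \<and> Y \<inter> T = {}"] ev[of "\<lambda>Y. insert t A \<subseteq> Y \<and> Y \<inter> T = {}"]
      by (simp only:) auto
    also have "\<dots> = Determinant.det (?D A T) - Determinant.det (?D (insert t A) T)"
      using insert.IH[of A] insert.IH[of "insert t A"] insert.prems insert.hyps by auto
    also have "\<dots> = Determinant.det (?D A (insert t T))"
      by (rule det_row_diff[symmetric, of _ n _ _ t]) (use K t insert.hyps in auto)
    finally show ?case .
  qed
qed

lemma dpp_point_probability:
  assumes dpp: "is_dpp n K M X" and S: "S \<subseteq> {..<n}"
  shows "measure M {\<omega> \<in> space M. X \<omega> = S} = Determinant.det (choose_rows S K (1\<^sub>m n - K))"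
proof -
  have K: "K \<in> carrier_mat n n" using dpp by (auto simp: is_dpp_def symmetric_matrix_def)
  have X: "X \<in> measurable M (count_space (Pow {..<n}))"
    using dpp by (auto simp: is_dpp_def point_process_def)
  have "X \<omega> = S \<longleftrightarrow> S \<subseteq> X \<omega> \<and> X \<omega> \<inter> ({..<n} - S) = {}" if "\<omega> \<in> space M" for \<omega>
    using measurable_space[OF X that] S by auto
  then have "{\<omega> \<in> space M. X \<omega> = S} =
      {\<omega> \<in> space M. S \<subseteq> X \<omega> \<and> X \<omega> \<inter> ({..<n} - S) = {}}" by blast
  moreover have "choose_rows S K (choose_rows ({..<n} - S) (1\<^sub>m n - K) (1\<^sub>m n)) =
      choose_rows S K (1\<^sub>m n - K)"
    using K by (intro eq_matI) auto
  ultimately show ?thesis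
    using dpp_inclusion_exclusion[OF dpp, of "{..<n} - S" S] S by auto
qed

section \<open>Positive semidefinite matrices\<close>

lemma symmetric_scalar_prod:
  assumes "symmetric_matrix n A" and x: "x \<in> carrier_vec n" and y: "y \<in> carrier_vec n"
  shows "scalar_prod x (A *\<^sub>v y) = scalar_prod (A *\<^sub>v x) y"
proof -
  have A: "A \<in> carrier_mat n n" "A\<^sup>T = A" using assms(1) by (auto simp: symmetric_matrix_def)
  have "scalar_prod (A\<^sup>T *\<^sub>v x) y = scalar_prod x (A *\<^sub>v y)"
    by (rule transpose_vec_mult_scalar[OF A(1) y x])
  then show ?thesis using A by simp
qed

text \<open>
  Writing \<open>z = K y\<close> and \<open>w = y - K y\<close>, the claim is that the product \<open>K (I - K)\<close> of commuting
  positive semidefinite matrices is again positive semidefinite, which the decomposition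
  \<open>K (I - K) = K (I - K) K + (I - K) K (I - K)\<close> into congruences of \<open>I - K\<close> and \<open>K\<close> shows.
\<close>

lemma loewner_product_nonneg:
  assumes K: "symmetric_matrix n K" and l0: "loewner_le n (0\<^sub>m n n) K" and l1: "loewner_le n K (1\<^sub>m n)"
    and y: "y \<in> carrier_vec n"
  shows "scalar_prod (y - K *\<^sub>v y) (K *\<^sub>v y) \<ge> 0"
proof -
  have Kc: "K \<in> carrier_mat n n" using K by (simp add: symmetric_matrix_def)
  define z where "z = K *\<^sub>v y"
  define w where "w = y - z"
  have z: "z \<in> carrier_vec n" and w: "w \<in> carrier_vec n" and Kz: "K *\<^sub>v z \<in> carrier_vec n"
    using Kc y by (auto simp: z_def w_def)
  have K0: "K - 0\<^sub>m n n = K" using Kc by (intro eq_matI) auto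
  have "0 \<le> scalar_prod w (K *\<^sub>v w)"
    using l0 w unfolding loewner_le_def psd_matrix_def K0 by blast
  moreover have "0 \<le> scalar_prod z ((1\<^sub>m n - K) *\<^sub>v z)"
    using l1 z unfolding loewner_le_def psd_matrix_def by blast
  moreover have "(1\<^sub>m n - K) *\<^sub>v z = z - K *\<^sub>v z"
    using minus_mult_distrib_mat_vec[of "1\<^sub>m n" n n K z] Kc z by simp
  moreover have "K *\<^sub>v w = z - K *\<^sub>v z"
    using mult_minus_distrib_mat_vec[OF Kc y z] by (simp add: w_def z_def)
  moreover have "scalar_prod w (z - K *\<^sub>v z) + scalar_prod z (z - K *\<^sub>v z) =
      scalar_prod y (z - K *\<^sub>v z)"
  proof -
    have "w + z = y" using y z by (auto simp: w_def)
    then show ?thesis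
      using add_scalar_prod_distrib[of w n z "z - K *\<^sub>v z"] w z Kz by simp
  qed
  moreover have "scalar_prod y (z - K *\<^sub>v z) = scalar_prod w z"
  proof -
    have "scalar_prod y (K *\<^sub>v w) = scalar_prod z w"
      using symmetric_scalar_prod[OF K y w] by (simp add: z_def)
    then show ?thesis
      using comm_scalar_prod[OF w z] mult_minus_distrib_mat_vec[OF Kc y z]
      by (simp add: w_def z_def)
  qed
  ultimately show ?thesis by (simp add: w_def z_def)
qed

lemma poly_char_poly:
  fixes A :: "'a::field mat"
  assumes A: "A \<in> carrier_mat n n"
  shows "poly (char_poly A) x = Determinant.det (x \<cdot>\<^sub>m 1\<^sub>m n - A)"
proof -
  have "- char_matrix A x = x \<cdot>\<^sub>m 1\<^sub>m n - A"
    using A by (intro eq_matI) (auto simp: char_matrix_def)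
  then show ?thesis using char_poly_matrix[OF A] by simp
qed

text \<open>
  The characteristic polynomial of \<open>A\<close> is monic, hence positive for large arguments. A negative
  value at \<open>1\<close> would force an eigenvalue \<open>x > 1\<close> of \<open>A\<close>, and \<open>v\<^sup>T (I - A) v < 0\<close> for its
  eigenvectors \<open>v\<close>.
\<close>

lemma det_one_minus_nonneg:
  assumes A: "A \<in> carrier_mat n n" and psd: "psd_matrix n (1\<^sub>m n - A)"
  shows "Determinant.det (1\<^sub>m n - A) \<ge> 0"
proof (rule ccontr)
  assume "\<not> ?thesis"
  then have neg: "poly (char_poly A) 1 < 0"
    using poly_char_poly[OF A, of 1] A by simp
  have lc: "lead_coeff (char_poly A) = 1" using degree_monic_char_poly[OF A] by auto
  then obtain b where b: "\<And>x. x \<ge> b \<Longrightarrow> poly (char_poly A) x \<ge> 1"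
    using poly_pinfty_gt_lc[of "char_poly A"] by auto
  have "poly (char_poly A) (max b 2) > 0" using b[of "max b 2"] by simp
  with neg obtain x where x: "x > 1" and "poly (char_poly A) x = 0"
    using poly_IVT_pos[of 1 "max b 2" "char_poly A"] by fastforce
  then have "eigenvalue A x" using eigenvalue_root_char_poly[OF A] by simp
  then obtain v where v: "v \<in> carrier_vec n" "v \<noteq> 0\<^sub>v n" and Av: "A *\<^sub>v v = x \<cdot>\<^sub>v v"
    using A by (auto simp: eigenvalue_def eigenvector_def)
  have "(1\<^sub>m n - A) *\<^sub>v v = (1 - x) \<cdot>\<^sub>v v"
    using minus_mult_distrib_mat_vec[of "1\<^sub>m n" n n A v] A v Av
    by (intro eq_vecI) (auto simp: algebra_simps)
  then have "0 \<le> scalar_prod v ((1 - x) \<cdot>\<^sub>v v)"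
    using psd v by (auto simp: psd_matrix_def)
  also have "\<dots> = (1 - x) * scalar_prod v v" using v by simp
  finally have "scalar_prod v v \<le> 0" using x by (simp add: zero_le_mult_iff)
  moreover have "scalar_prod v v > 0"
  proof -
    obtain i where i: "i < n" "v $ i \<noteq> 0" using v by (metis carrier_vecD eq_vecI index_zero_vec)
    have "0 < (v $ i) * (v $ i)" using i(2) by (auto simp: zero_less_mult_iff linorder_neq_iff)
    also have "\<dots> \<le> (\<Sum>i\<in>{0..<n}. v $ i * v $ i)"
      by (rule member_le_sum) (use i in auto)
    finally show ?thesis using v by (simp add: scalar_prod_def)
  qed
  ultimately show False by simp
qed

section \<open>Splitting off the eigenvalue one\<close>

locale unit_eigenspace =
  fixes n p :: nat and K V :: "real mat"
  assumes K_sym: "symmetric_matrix n K"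
    and V [simp]: "V \<in> carrier_mat n p"
    and VtV: "V\<^sup>T * V = 1\<^sub>m p"
    and KV: "K * V = V"
begin

definition P where "P = V * V\<^sup>T"

text \<open>
  \<open>K1\<close> agrees with \<open>K\<close> on the orthogonal complement of the column space of \<open>V\<close> and vanishes on the
  column space itself.
\<close>

definition K1 where "K1 = K - P"

abbreviation "M \<equiv> 1\<^sub>m n - K1"

lemma carriers [simp]:
  "K \<in> carrier_mat n n" "P \<in> carrier_mat n n" "K1 \<in> carrier_mat n n" "V\<^sup>T \<in> carrier_mat p n"
  "M \<in> carrier_mat n n"
proof -
  show K: "K \<in> carrier_mat n n" using K_sym by (simp add: symmetric_matrix_def)
  show "P \<in> carrier_mat n n" unfolding P_def by (rule mult_carrier_mat[of _ n p]) auto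
  then show "K1 \<in> carrier_mat n n" unfolding K1_def by (rule minus_carrier_mat)
  then show "M \<in> carrier_mat n n" by (rule minus_carrier_mat)
qed simp

lemma dims [simp]:
  "dim_row K = n" "dim_col K = n" "dim_row P = n" "dim_col P = n"
  "dim_row K1 = n" "dim_col K1 = n" "dim_row V = n" "dim_col V = p"
  using carriers(1-3) V by (auto simp del: carriers V)

lemma transposes: "K\<^sup>T = K" "P\<^sup>T = P" "K1\<^sup>T = K1" "M\<^sup>T = M"
proof -
  show K: "K\<^sup>T = K" using K_sym by (simp add: symmetric_matrix_def)
  show P: "P\<^sup>T = P" by (simp add: P_def transpose_mult[OF V carriers(4)])
  show K1: "K1\<^sup>T = K1"
    using K P transpose_minus[of K n n P] by (simp add: K1_def)
  show "M\<^sup>T = M" using K1 transpose_minus[of "1\<^sub>m n" n n K1] by simp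
qed

lemma PV: "P * V = V"
  using VtV assoc_mult_mat[OF V carriers(4) V] right_mult_one_mat[OF V] by (simp add: P_def)

lemma K1V: "K1 * V = 0\<^sub>m n p"
  using minus_mult_distrib_mat[of K n n P V p] V by (auto simp: K1_def KV PV)

lemma K1P: "K1 * P = 0\<^sub>m n n"
  using K1V assoc_mult_mat[of K1 n n V p "V\<^sup>T" n] V by (simp add: P_def)

lemma VtK1: "V\<^sup>T * K1 = 0\<^sub>m p n"
proof -
  have "(V\<^sup>T * K1)\<^sup>T = K1 * V"
    using transpose_mult[OF carriers(4) carriers(3)] transposes by simp
  then have "(V\<^sup>T * K1)\<^sup>T\<^sup>T = (0\<^sub>m n p)\<^sup>T" by (simp add: K1V)
  then show ?thesis by simp
qed

lemma MV: "M * V = V"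
  using minus_mult_distrib_mat[of "1\<^sub>m n" n n K1 V p] V by (simp add: K1V)

lemma VtM: "V\<^sup>T * M = V\<^sup>T"
  using mult_minus_distrib_mat[of "V\<^sup>T" p n "1\<^sub>m n" n K1] right_mult_one_mat[OF carriers(4)]
  by (simp add: VtK1)

text \<open>
  Sylvester's identity for \<open>V V\<^sup>T\<close> and \<open>V\<^sup>T V = I\<close>, read off from two column reductions of the
  matrix with blocks \<open>x I\<close>, \<open>V\<close>, \<open>V\<^sup>T\<close>, \<open>I\<close>.
\<close>

lemma det_projection:
  "Determinant.det (x \<cdot>\<^sub>m 1\<^sub>m n - P) * x ^ p = x ^ n * (x - 1) ^ p"
proof -
  define T where "T = four_block_mat (x \<cdot>\<^sub>m 1\<^sub>m n) V (V\<^sup>T) (1\<^sub>m p)"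
  have T: "T \<in> carrier_mat (n + p) (n + p)" by (simp add: T_def)
  have "T * four_block_mat (1\<^sub>m n) (0\<^sub>m n p) (- (V\<^sup>T)) (1\<^sub>m p) =
      four_block_mat (x \<cdot>\<^sub>m 1\<^sub>m n - P) V (0\<^sub>m p n) (1\<^sub>m p)"
  proof -
    have "x \<cdot>\<^sub>m 1\<^sub>m n * 1\<^sub>m n + V * - (V\<^sup>T) = x \<cdot>\<^sub>m 1\<^sub>m n - P"
      using carriers(2) by (intro eq_matI) (auto simp: P_def)
    moreover have "x \<cdot>\<^sub>m 1\<^sub>m n * 0\<^sub>m n p + V * 1\<^sub>m p = V"
      using V right_mult_one_mat[OF V] right_mult_zero_mat[of "x \<cdot>\<^sub>m 1\<^sub>m n" n n p] by simp
    moreover have "V\<^sup>T * 1\<^sub>m n + 1\<^sub>m p * - (V\<^sup>T) = 0\<^sub>m p n"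
      by (intro eq_matI) auto
    moreover have "V\<^sup>T * 0\<^sub>m n p + 1\<^sub>m p * 1\<^sub>m p = 1\<^sub>m p"
      using right_mult_zero_mat[OF carriers(4), of p] by simp
    ultimately show ?thesis
      unfolding T_def by (subst mult_four_block_mat[of _ n n _ p _ p]) auto
  qed
  then have "Determinant.det T * 1 = Determinant.det (x \<cdot>\<^sub>m 1\<^sub>m n - P)"
    using det_mult[OF T, of "four_block_mat (1\<^sub>m n) (0\<^sub>m n p) (- (V\<^sup>T)) (1\<^sub>m p)"]
      det_four_block_mat_upper_right_zero[of "1\<^sub>m n" n "0\<^sub>m n p" p "- (V\<^sup>T)" "1\<^sub>m p"]
      det_four_block_mat_lower_left_zero[of "x \<cdot>\<^sub>m 1\<^sub>m n - P" n V p "0\<^sub>m p n" "1\<^sub>m p"]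
    by (simp add: minus_carrier_mat)
  moreover have "T * four_block_mat (1\<^sub>m n) (- V) (0\<^sub>m p n) (x \<cdot>\<^sub>m 1\<^sub>m p) =
      four_block_mat (x \<cdot>\<^sub>m 1\<^sub>m n) (0\<^sub>m n p) (V\<^sup>T) ((x - 1) \<cdot>\<^sub>m 1\<^sub>m p)"
  proof -
    have "x \<cdot>\<^sub>m 1\<^sub>m n * - V + V * (x \<cdot>\<^sub>m 1\<^sub>m p) = 0\<^sub>m n p"
      using V mult_smult_distrib[OF V, of "1\<^sub>m p" p x] mult_smult_assoc_mat[of "1\<^sub>m n" n n "- V" p x]
      by (intro eq_matI) auto
    moreover have "V\<^sup>T * - V + 1\<^sub>m p * (x \<cdot>\<^sub>m 1\<^sub>m p) = (x - 1) \<cdot>\<^sub>m 1\<^sub>m p"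
      using V VtV by (intro eq_matI) auto
    ultimately show ?thesis
      unfolding T_def by (subst mult_four_block_mat[of _ n n _ p _ p]) auto
  qed
  then have "Determinant.det T * x ^ p = x ^ n * (x - 1) ^ p"
    using det_mult[OF T, of "four_block_mat (1\<^sub>m n) (- V) (0\<^sub>m p n) (x \<cdot>\<^sub>m 1\<^sub>m p)"]
      det_four_block_mat_upper_right_zero[of "x \<cdot>\<^sub>m 1\<^sub>m n" n "0\<^sub>m n p" p "V\<^sup>T" "(x - 1) \<cdot>\<^sub>m 1\<^sub>m p"]
      det_four_block_mat_lower_left_zero[of "1\<^sub>m n" n "- V" p "0\<^sub>m p n" "x \<cdot>\<^sub>m 1\<^sub>m p"]
    by simp
  ultimately show ?thesis by simp
qed

text \<open>The reason is the matrix identity \<open>(x I - K1) (x I - P) = x (x I - K)\<close>, due to \<open>K1 P = 0\<close>.\<close>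

lemma det_pencil_split:
  "x ^ n * Determinant.det (x \<cdot>\<^sub>m 1\<^sub>m n - K) =
   Determinant.det (x \<cdot>\<^sub>m 1\<^sub>m n - K1) * Determinant.det (x \<cdot>\<^sub>m 1\<^sub>m n - P)"
proof -
  have "(x \<cdot>\<^sub>m 1\<^sub>m n - K1) * (x \<cdot>\<^sub>m 1\<^sub>m n - P) =
      x \<cdot>\<^sub>m 1\<^sub>m n * (x \<cdot>\<^sub>m 1\<^sub>m n - P) - K1 * (x \<cdot>\<^sub>m 1\<^sub>m n - P)"
    by (rule minus_mult_distrib_mat[of _ n n _ _ n]) (auto intro: minus_carrier_mat)
  also have "K1 * (x \<cdot>\<^sub>m 1\<^sub>m n - P) = x \<cdot>\<^sub>m K1"
    using mult_minus_distrib_mat[of K1 n n "x \<cdot>\<^sub>m 1\<^sub>m n" n P] mult_smult_distrib[of K1 n n "1\<^sub>m n" n x]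
    by (simp add: K1P)
  also have "x \<cdot>\<^sub>m 1\<^sub>m n * (x \<cdot>\<^sub>m 1\<^sub>m n - P) = x \<cdot>\<^sub>m (x \<cdot>\<^sub>m 1\<^sub>m n - P)"
    using mult_smult_assoc_mat[of "1\<^sub>m n" n n "x \<cdot>\<^sub>m 1\<^sub>m n - P" n x]
    by (simp add: minus_carrier_mat)
  also have "x \<cdot>\<^sub>m (x \<cdot>\<^sub>m 1\<^sub>m n - P) - x \<cdot>\<^sub>m K1 = x \<cdot>\<^sub>m (x \<cdot>\<^sub>m 1\<^sub>m n - K)"
    using carriers by (intro eq_matI) (auto simp: K1_def algebra_simps)
  finally show ?thesis
    using det_mult[of "x \<cdot>\<^sub>m 1\<^sub>m n - K1" n "x \<cdot>\<^sub>m 1\<^sub>m n - P"]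
    by (simp add: minus_carrier_mat)
qed

text \<open>
  The columns of \<open>V\<close> already account for the whole algebraic multiplicity of the eigenvalue \<open>1\<close>,
  so none is left for \<open>K1\<close>: compare the orders of vanishing at \<open>1\<close> in
  \<open>x\<^sup>n\<^sup>+\<^sup>p \<chi>\<^sub>K = \<chi>\<^sub>K\<^sub>1 x\<^sup>n (x - 1)\<^sup>p\<close>.
\<close>

lemma det_M_nonzero:
  assumes "p = Polynomial.order 1 (char_poly K)"
  shows "Determinant.det M \<noteq> 0"
proof -
  let ?X = "[:0, 1::real:]" and ?Y = "[:- 1, 1::real:]"
  have nz: "char_poly A \<noteq> 0" if "A \<in> carrier_mat n n" for A :: "real mat"
    using degree_monic_char_poly[OF that] by auto
  have "poly (?X ^ (n + p) * char_poly K) x = poly (char_poly K1 * ?X ^ n * ?Y ^ p) x" for x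
  proof -
    have "x ^ (n + p) * Determinant.det (x \<cdot>\<^sub>m 1\<^sub>m n - K) =
        Determinant.det (x \<cdot>\<^sub>m 1\<^sub>m n - K1) * (Determinant.det (x \<cdot>\<^sub>m 1\<^sub>m n - P) * x ^ p)"
      using det_pencil_split[of x] by (simp add: power_add)
    then show ?thesis
      by (simp add: det_projection poly_char_poly[of _ n])
  qed
  then have eq: "?X ^ (n + p) * char_poly K = char_poly K1 * ?X ^ n * ?Y ^ p"
    by (intro poly_eq_poly_eq_iff[THEN iffD1] ext)
  have X: "Polynomial.order 1 (?X ^ k) = 0" for k by (rule order_0I) simp
  have "Polynomial.order 1 (?X ^ (n + p) * char_poly K) = p"
    using nz[of K] by (subst order_mult) (auto simp: X assms[symmetric])
  moreover have "Polynomial.order 1 (char_poly K1 * ?X ^ n * ?Y ^ p) =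
      Polynomial.order 1 (char_poly K1) + p"
    using nz[of K1] by (subst order_mult, simp)+ (simp add: X order_power_n_n)
  ultimately have "Polynomial.order 1 (char_poly K1) = 0" using eq by simp
  then have "poly (char_poly K1) 1 \<noteq> 0" using order_root[of "char_poly K1" 1] nz[of K1] by simp
  then show ?thesis using poly_char_poly[of K1 n 1] by simp
qed

lemma psd_M:
  assumes "loewner_le n K (1\<^sub>m n)"
  shows "psd_matrix n M"
proof -
  have "scalar_prod x (M *\<^sub>v x) \<ge> 0" if x: "x \<in> carrier_vec n" for x
  proof -
    have VtX: "V\<^sup>T *\<^sub>v x \<in> carrier_vec p" by (rule mult_mat_vec_carrier[OF carriers(4) x])
    have "M = (1\<^sub>m n - K) + P"
      by (intro eq_matI) (auto simp: K1_def)
    then have "M *\<^sub>v x = (1\<^sub>m n - K) *\<^sub>v x + P *\<^sub>v x"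
      using add_mult_distrib_mat_vec[of "1\<^sub>m n - K" n n P x] x
      by (simp add: minus_carrier_mat)
    moreover have "P *\<^sub>v x = V *\<^sub>v (V\<^sup>T *\<^sub>v x)"
      using assoc_mult_mat_vec[OF V carriers(4) x] by (simp add: P_def)
    moreover have "scalar_prod x (V *\<^sub>v (V\<^sup>T *\<^sub>v x)) = scalar_prod (V\<^sup>T *\<^sub>v x) (V\<^sup>T *\<^sub>v x)"
      using transpose_vec_mult_scalar[OF V VtX x] by simp
    moreover have "scalar_prod (V\<^sup>T *\<^sub>v x) (V\<^sup>T *\<^sub>v x) \<ge> 0"
      by (auto simp: scalar_prod_def intro!: sum_nonneg)
    moreover have "scalar_prod x ((1\<^sub>m n - K) *\<^sub>v x) \<ge> 0"
      using assms x by (auto simp: loewner_le_def psd_matrix_def)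
    ultimately show ?thesis
      using scalar_prod_add_distrib[of x n "(1\<^sub>m n - K) *\<^sub>v x" "V *\<^sub>v (V\<^sup>T *\<^sub>v x)"] x
        mult_mat_vec_carrier[OF V VtX] mult_mat_vec_carrier[of "1\<^sub>m n - K" n n x]
      by (simp add: minus_carrier_mat)
  qed
  then show ?thesis using transposes by (simp add: psd_matrix_def symmetric_matrix_def)
qed

section \<open>The determinant of the bordered matrix\<close>

text \<open>
  If \<open>L M = K1\<close>, multiplying the full-size bordered matrix from the right by the block lower triangular
  matrix with blocks \<open>M\<close>, \<open>0\<close>, \<open>2 V\<^sup>T\<close>, \<open>I\<close> clears the inverse hidden in \<open>L\<close>. Its upper left
  block becomes \<open>R + P\<close>, where \<open>R\<close> takes the rows in \<open>S\<close> from \<open>K\<close> and the others from \<open>I - K\<close>;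
  the factor 2 balances \<open>K1 + 2 P = K + P\<close> on \<open>S\<close> against \<open>M = (I - K) + P\<close> off \<open>S\<close>. Since \<open>R V\<close>
  is the upper right block and \<open>V\<^sup>T V = I\<close>, the product equals \<open>U W U\<close> with \<open>U\<close> unipotent and \<open>W\<close>
  block triangular with diagonal blocks \<open>R\<close> and \<open>-I\<close>.
\<close>

lemma det_bordered:
  assumes L: "L \<in> carrier_mat n n" and LM: "L * M = K1" and S: "S \<subseteq> {..<n}"
  shows "Determinant.det (bordered_matrix p L V S) * Determinant.det M =
         (- 1) ^ p * Determinant.det (choose_rows S K (1\<^sub>m n - K))"
proof -
  define R where "R = choose_rows S K (1\<^sub>m n - K)"
  define D where "D = choose_rows S V (0\<^sub>m n p)"
  define Q where "Q = choose_rows S L (1\<^sub>m n)"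
  define T where "T = four_block_mat Q D (V\<^sup>T) (0\<^sub>m p p)"
  define E where "E = four_block_mat M (0\<^sub>m n p) (2 \<cdot>\<^sub>m V\<^sup>T) (1\<^sub>m p)"
  define U where "U = four_block_mat (1\<^sub>m n) V (0\<^sub>m p n) (1\<^sub>m p)"
  define W where "W = four_block_mat R (0\<^sub>m n p) (V\<^sup>T) (- 1\<^sub>m p)"
  have R: "R \<in> carrier_mat n n" and D: "D \<in> carrier_mat n p" and Q: "Q \<in> carrier_mat n n"
    using L by (auto simp: R_def D_def Q_def)
  have neg1: "(- 1\<^sub>m p :: real mat) \<in> carrier_mat p p" by (intro uminus_carrier_mat) auto
  have T: "T \<in> carrier_mat (n + p) (n + p)" and E: "E \<in> carrier_mat (n + p) (n + p)"
    and U: "U \<in> carrier_mat (n + p) (n + p)" and W: "W \<in> carrier_mat (n + p) (n + p)"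
    using Q R neg1 by (auto simp: T_def E_def U_def W_def)
  have RV: "R * V = D"
  proof -
    have "R * V = choose_rows S (K * V) ((1\<^sub>m n - K) * V)"
      unfolding R_def by (rule choose_rows_mult) (auto intro: minus_carrier_mat)
    moreover have "(1\<^sub>m n - K) * V = V - V"
      using minus_mult_distrib_mat[of "1\<^sub>m n" n n K V p] KV by simp
    moreover have "V - V = 0\<^sub>m n p" by (intro eq_matI) auto
    ultimately show ?thesis by (simp add: KV D_def)
  qed
  have TE: "T * E = four_block_mat (R + P) D (V\<^sup>T) (0\<^sub>m p p)"
  proof -
    have "Q * M = choose_rows S K1 M"
      using choose_rows_mult[OF L one_carrier_mat carriers(5)] LM
        left_mult_one_mat[OF carriers(5)] by (simp add: Q_def)
    moreover have "D * (2 \<cdot>\<^sub>m V\<^sup>T) = choose_rows S (2 \<cdot>\<^sub>m P) (0\<^sub>m n n)"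
      unfolding D_def using choose_rows_mult[of V n p "0\<^sub>m n p" "2 \<cdot>\<^sub>m V\<^sup>T" n]
        mult_smult_distrib[OF V carriers(4), of 2]
      by (simp add: P_def)
    moreover have "choose_rows S K1 M + choose_rows S (2 \<cdot>\<^sub>m P) (0\<^sub>m n n) = R + P"
      by (intro eq_matI) (auto simp: R_def K1_def)
    moreover have "Q * 0\<^sub>m n p + D * 1\<^sub>m p = D"
      using Q D by simp
    moreover have "V\<^sup>T * M + 0\<^sub>m p p * (2 \<cdot>\<^sub>m V\<^sup>T) = V\<^sup>T" by (simp add: VtM)
    moreover have "V\<^sup>T * 0\<^sub>m n p + 0\<^sub>m p p * 1\<^sub>m p = 0\<^sub>m p p" by simp
    ultimately show ?thesis
      unfolding T_def E_def using Q D by (subst mult_four_block_mat[of _ n n _ p _ p]) auto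
  qed
  have UW: "U * W = four_block_mat (R + P) (- V) (V\<^sup>T) (- 1\<^sub>m p)"
  proof -
    have "1\<^sub>m n * R + V * V\<^sup>T = R + P" using R by (simp add: P_def)
    moreover have "1\<^sub>m n * 0\<^sub>m n p + V * - 1\<^sub>m p = - V" by simp
    moreover have "0\<^sub>m p n * R + 1\<^sub>m p * V\<^sup>T = V\<^sup>T" using R by simp
    moreover have "0\<^sub>m p n * 0\<^sub>m n p + 1\<^sub>m p * - 1\<^sub>m p = (- 1\<^sub>m p :: real mat)" by simp
    ultimately show ?thesis
      unfolding U_def W_def using R neg1 by (subst mult_four_block_mat[of _ n n _ p _ p]) auto
  qed
  have UWU: "U * W * U = four_block_mat (R + P) D (V\<^sup>T) (0\<^sub>m p p)"
  proof -
    have "(R + P) * 1\<^sub>m n + - V * 0\<^sub>m p n = R + P" using R by simp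
    moreover have "(R + P) * V + - V * 1\<^sub>m p = D"
      using add_mult_distrib_mat[OF R carriers(2) V] D
      by (intro eq_matI) (auto simp: RV PV)
    moreover have "V\<^sup>T * 1\<^sub>m n + - 1\<^sub>m p * 0\<^sub>m p n = V\<^sup>T" by simp
    moreover have "V\<^sup>T * V + - 1\<^sub>m p * 1\<^sub>m p = 0\<^sub>m p p"
      by (intro eq_matI) (auto simp: VtV)
    ultimately show ?thesis
      unfolding UW unfolding U_def using R neg1 uminus_carrier_mat[OF V]
      by (subst mult_four_block_mat[of _ n n _ p _ p]) auto
  qed
  have "Determinant.det T * Determinant.det E =
      Determinant.det U * Determinant.det W * Determinant.det U"
    using TE UWU det_mult[OF T E] det_mult[OF U W] det_mult[of "U * W" "n + p" U] U W by simp
  moreover have "Determinant.det E = Determinant.det M"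
    unfolding E_def using det_four_block_mat_upper_right_zero[of M n "0\<^sub>m n p" p "2 \<cdot>\<^sub>m V\<^sup>T" "1\<^sub>m p"]
    by simp
  moreover have "Determinant.det U = 1"
    unfolding U_def using det_four_block_mat_lower_left_zero[of "1\<^sub>m n" n V p "0\<^sub>m p n" "1\<^sub>m p"]
    by simp
  moreover have "Determinant.det W = (- 1) ^ p * Determinant.det R"
  proof -
    have "- 1\<^sub>m p = (- 1 :: real) \<cdot>\<^sub>m 1\<^sub>m p" by (intro eq_matI) auto
    then show ?thesis
      unfolding W_def using det_four_block_mat_upper_right_zero[of R n "0\<^sub>m n p" p "V\<^sup>T" "- 1\<^sub>m p"] R
      by simp
  qed
  ultimately show ?thesis
    using det_bordered_matrix[OF L V S] by (simp add: T_def Q_def D_def R_def)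
qed

section \<open>The nonnegative pair\<close>

text \<open>
  Invertibility of \<open>M\<close> means that the columns of \<open>V\<close> span the eigenspace of \<open>1\<close>.
  The matrices \<open>I - K\<close> and \<open>M\<close> agree on the orthogonal complement of the eigenspace, where the
  pseudo-inverse must therefore be the inverse \<open>G\<close> of \<open>M\<close>. On the eigenspace itself \<open>I - K\<close> vanishes,
  and so must the pseudo-inverse; subtracting \<open>P\<close> achieves this since \<open>G\<close> is the identity there.
\<close>

lemma moore_penrose_one_minus:
  assumes G: "G \<in> carrier_mat n n" and MG: "M * G = 1\<^sub>m n" and GM: "G * M = 1\<^sub>m n"
  shows "moore_penrose (1\<^sub>m n - K) = G - P" and "G * V = V" and "V\<^sup>T * G = V\<^sup>T"
    and "symmetric_matrix n G"
proof -
  show GV: "G * V = V"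
    using assoc_mult_mat[OF G carriers(5) V] by (simp add: MV GM)
  show VtG: "V\<^sup>T * G = V\<^sup>T"
    using assoc_mult_mat[OF carriers(4,5) G] by (simp add: VtM MG)
  have "G\<^sup>T * M = 1\<^sub>m n"
    using arg_cong[OF MG, of transpose_mat] transpose_mult[OF carriers(5) G] by (simp add: transposes)
  then have "G\<^sup>T = G"
    using assoc_mult_mat[of "G\<^sup>T" n n M n G n] G MG by simp
  then show "symmetric_matrix n G" using G by (simp add: symmetric_matrix_def)
  have GP: "G * P = P" and PG: "P * G = P" and PP: "P * P = P"
    using assoc_mult_mat[OF G V carriers(4)] assoc_mult_mat[OF V carriers(4) G]
      assoc_mult_mat[OF carriers(2) V carriers(4)] by (simp_all add: P_def[symmetric] GV VtG PV)
  have MP: "M * P = P" and PM: "P * M = P"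
    using assoc_mult_mat[OF carriers(5) V carriers(4)] assoc_mult_mat[OF V carriers(4,5)]
    by (simp_all add: P_def[symmetric] MV VtM)
  define A where "A = 1\<^sub>m n - K"
  define B where "B = G - P"
  have A: "A \<in> carrier_mat n n" and B: "B \<in> carrier_mat n n"
    by (auto simp: A_def B_def intro: minus_carrier_mat)
  have AM: "A = M - P" by (intro eq_matI) (auto simp: A_def K1_def)
  have AG: "A * G = 1\<^sub>m n - P" "A * P = 0\<^sub>m n n" "G * A = 1\<^sub>m n - P" "P * A = 0\<^sub>m n n"
    unfolding AM
    using minus_mult_distrib_mat[OF carriers(5,2) G] minus_mult_distrib_mat[OF carriers(5,2,2)]
      mult_minus_distrib_mat[OF G carriers(5,2)] mult_minus_distrib_mat[OF carriers(2,5,2)]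
    by (auto simp: MG GM MP PM PG GP PP)
  have AB: "A * B = 1\<^sub>m n - P"
    using mult_minus_distrib_mat[OF A G carriers(2)] minus_carrier_mat[OF carriers(2)]
    by (simp add: AG B_def)
  have BA: "B * A = 1\<^sub>m n - P"
    using minus_mult_distrib_mat[OF G carriers(2) A] minus_carrier_mat[OF carriers(2)]
    by (simp add: AG B_def)
  have "A * B * A = A"
    unfolding AB using minus_mult_distrib_mat[OF one_carrier_mat carriers(2) A] A by (simp add: AG)
  moreover have "B * A * B = B"
  proof -
    have "P * B = 0\<^sub>m n n"
      unfolding B_def using mult_minus_distrib_mat[OF carriers(2) G carriers(2)] by (simp add: PG PP)
    then show ?thesis
      unfolding BA using minus_mult_distrib_mat[OF one_carrier_mat carriers(2) B] B by simp
  qed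
  moreover have "(1\<^sub>m n - P)\<^sup>T = 1\<^sub>m n - P"
    using transpose_minus[of "1\<^sub>m n" n n P] by (simp add: transposes)
  ultimately have "is_moore_penrose A B"
    using A B by (auto simp: is_moore_penrose_def AB BA)
  then show "moore_penrose (1\<^sub>m n - K) = G - P"
    unfolding moore_penrose_def A_def[symmetric] B_def[symmetric]
    by (intro the_equality) (auto intro: is_moore_penrose_unique)
qed

lemma kernel_times_moore_penrose:
  assumes G: "G \<in> carrier_mat n n" and MG: "M * G = 1\<^sub>m n" and GM: "G * M = 1\<^sub>m n"
  shows "K * moore_penrose (1\<^sub>m n - K) = G - 1\<^sub>m n" and "(G - 1\<^sub>m n) * M = K1"
proof -
  have "K = (1\<^sub>m n - M) + P" by (intro eq_matI) (auto simp: K1_def)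
  then have "K * G = (1\<^sub>m n - M) * G + P * G"
    using add_mult_distrib_mat[of "1\<^sub>m n - M" n n P G n] G by (simp add: minus_carrier_mat)
  moreover have "(1\<^sub>m n - M) * G = G - 1\<^sub>m n"
    using minus_mult_distrib_mat[OF one_carrier_mat carriers(5) G] G MG by simp
  moreover have "P * G = P"
    using assoc_mult_mat[OF V carriers(4) G] moore_penrose_one_minus(3)[OF assms]
    by (simp add: P_def)
  moreover have "K * P = P"
    using assoc_mult_mat[OF carriers(1) V carriers(4)] by (simp add: P_def KV)
  ultimately have "K * (G - P) = G - 1\<^sub>m n + P - P"
    using mult_minus_distrib_mat[OF carriers(1) G carriers(2)] by simp
  also have "\<dots> = G - 1\<^sub>m n" using G by (intro eq_matI) auto
  finally show "K * moore_penrose (1\<^sub>m n - K) = G - 1\<^sub>m n"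
    using moore_penrose_one_minus(1)[OF assms] by simp
  have "(G - 1\<^sub>m n) * M = 1\<^sub>m n - M"
    using minus_mult_distrib_mat[OF G one_carrier_mat carriers(5)] GM
      left_mult_one_mat[OF carriers(5)] by simp
  also have "\<dots> = K1" by (intro eq_matI) auto
  finally show "(G - 1\<^sub>m n) * M = K1" .
qed

text \<open>
  For \<open>V\<^sup>T x = 0\<close> put \<open>y = G x\<close>. Then \<open>V\<^sup>T y = 0\<close> as well, so that \<open>K1 y = K y\<close>; hence
  \<open>x = M y = y - K y\<close> and \<open>(G - I) x = K y\<close>.
\<close>

lemma cond_psd_inverse_minus_one:
  assumes G: "G \<in> carrier_mat n n" and MG: "M * G = 1\<^sub>m n" and GM: "G * M = 1\<^sub>m n"
    and l0: "loewner_le n (0\<^sub>m n n) K" and l1: "loewner_le n K (1\<^sub>m n)"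
  shows "cond_psd n p (G - 1\<^sub>m n) V"
  unfolding cond_psd_def
proof (intro ballI impI)
  fix x assume x: "x \<in> carrier_vec n" and Vx: "V\<^sup>T *\<^sub>v x = 0\<^sub>v p"
  define y where "y = G *\<^sub>v x"
  have y: "y \<in> carrier_vec n" using G x by (simp add: y_def)
  have "V\<^sup>T *\<^sub>v y = 0\<^sub>v p"
    using assoc_mult_mat_vec[OF carriers(4) G x] moore_penrose_one_minus(3)[OF assms(1-3)] Vx
    by (simp add: y_def)
  then have "P *\<^sub>v y = 0\<^sub>v n"
    using assoc_mult_mat_vec[OF V carriers(4) y] by (simp add: P_def mult_mat_vec_def) auto
  then have "K1 *\<^sub>v y = K *\<^sub>v y"
    using minus_mult_distrib_mat_vec[OF carriers(1,2) y] mult_mat_vec_carrier[OF carriers(1) y]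
    by (simp add: K1_def)
  then have "M *\<^sub>v y = y - K *\<^sub>v y"
    using minus_mult_distrib_mat_vec[OF one_carrier_mat carriers(3) y] y by simp
  moreover have "M *\<^sub>v y = x"
    using assoc_mult_mat_vec[OF carriers(5) G x] MG x by (simp add: y_def)
  ultimately have xy: "x = y - K *\<^sub>v y" by simp
  have "(G - 1\<^sub>m n) *\<^sub>v x = y - x"
    using minus_mult_distrib_mat_vec[OF G one_carrier_mat x] x by (simp add: y_def)
  also have "\<dots> = K *\<^sub>v y" unfolding xy using y by (intro eq_vecI) auto
  finally show "scalar_prod x ((G - 1\<^sub>m n) *\<^sub>v x) \<ge> 0"
    using loewner_product_nonneg[OF K_sym l0 l1 y] xy by simp
qed

text \<open>
  Orthonormality makes \<open>V\<^sup>T\<close> a left inverse, so a linear relation among the columns is trivial. That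
  the columns are distinct has to be shown separately, because independence of the set of columns
  alone does not exclude repetitions.
\<close>

lemma rank_V: "vec_space.rank n V = p"
proof -
  interpret vec_space "TYPE(real)" n .
  have dist: "distinct (cols V)"
  proof (rule distinct_conv_nth[THEN iffD2], intro allI impI)
    fix i j assume i: "i < length (cols V)" and j: "j < length (cols V)" and ij: "i \<noteq> j"
    then have "scalar_prod (col V i) (col V j) = 0" "scalar_prod (col V i) (col V i) = 1"
      using arg_cong[OF VtV, of "\<lambda>A. A $$ (i, j)"] arg_cong[OF VtV, of "\<lambda>A. A $$ (i, i)"] by auto
    then show "cols V ! i \<noteq> cols V ! j" using i j by auto
  qed
  have "\<not> lin_dep (set (cols V))"
  proof
    assume "lin_dep (set (cols V))"
    then obtain v where v: "v \<in> carrier_vec p" "v \<noteq> 0\<^sub>v p" "V *\<^sub>v v = 0\<^sub>v n"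
      using lin_depE[OF V _ dist] by blast
    have "v = V\<^sup>T *\<^sub>v (V *\<^sub>v v)"
      using assoc_mult_mat_vec[OF carriers(4) V v(1)] v(1) by (simp add: VtV)
    also have "\<dots> = 0\<^sub>v p" unfolding v(3) by (intro eq_vecI) auto
    finally show False using v(2) by simp
  qed
  then show ?thesis using lin_indpt_full_rank[OF V dist] by simp
qed

end

section \<open>Determinantal processes as extended L-ensembles\<close>

theorem theorem2p10:
  fixes n p :: nat
    and K V L :: "real mat"
    and M :: "'a measure"
    and X :: "'a \<Rightarrow> nat set"
  assumes "symmetric_matrix n K"
    and "loewner_le n (0\<^sub>m n n) K"
    and "loewner_le n K (1\<^sub>m n)"
    and "is_dpp n K M X"
    and "p = Polynomial.order 1 (char_poly K)"
    and "V \<in> carrier_mat n p"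
    and "\<forall>j < p. eigenvector K (col V j) 1"
    and "\<forall>i < p. \<forall>j < p. scalar_prod (col V i) (col V j) = (if i = j then 1 else 0)"
    and "L = K * moore_penrose (1\<^sub>m n - K)"
  shows "nonneg_pair n p L V \<and> is_extended_L_ensemble n p L V M X"
proof -
  have K: "K \<in> carrier_mat n n" using assms(1) by (simp add: symmetric_matrix_def)
  interpret E: unit_eigenspace n p K V
  proof
    show "V\<^sup>T * V = 1\<^sub>m p"
      using assms(6,8) by (intro eq_matI) auto
    show "K * V = V"
    proof (rule mat_col_eqI)
      fix j assume "j < dim_col V"
      then show "col (K * V) j = col V j"
        using assms(6,7) col_mult2[OF K assms(6), of j] by (simp add: eigenvector_def)
    qed (use K assms(6) in auto)
  qed (use assms(1,6) in auto)
  have "Determinant.det E.M \<noteq> 0" using E.det_M_nonzero[OF assms(5)] .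
  moreover have "Determinant.det E.M \<ge> 0"
    by (rule det_one_minus_nonneg[OF E.carriers(3) E.psd_M[OF assms(3)]])
  ultimately have pos: "Determinant.det E.M > 0" by simp
  then obtain G where G: "G \<in> carrier_mat n n" and MG: "E.M * G = 1\<^sub>m n" and GM: "G * E.M = 1\<^sub>m n"
    using det_non_zero_imp_unit[OF E.carriers(5), of "()"]
    by (auto simp: Units_def ring_mat_def)
  have L: "L = G - 1\<^sub>m n" and LM: "L * E.M = E.K1"
    using E.kernel_times_moore_penrose[OF G MG GM] assms(9) by auto
  have Lc: "L \<in> carrier_mat n n" unfolding L by (rule minus_carrier_mat) simp
  have nnp: "nonneg_pair n p L V"
    unfolding nonneg_pair_def
  proof (intro conjI)
    show "symmetric_matrix n L"
      using E.moore_penrose_one_minus(4)[OF G MG GM] Lc transpose_minus[OF G one_carrier_mat]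
      by (simp add: symmetric_matrix_def L)
    have "Polynomial.order 1 (char_poly K) \<le> degree (char_poly K)"
      using degree_monic_char_poly[OF K] by (intro order_degree) auto
    then show "p \<le> n" using degree_monic_char_poly[OF K] assms(5) by simp
    show "cond_psd n p L V"
      unfolding L by (rule E.cond_psd_inverse_minus_one[OF G MG GM assms(2,3)])
  qed (use assms(6) E.rank_V in auto)
  have "measure M {\<omega> \<in> space M. X \<omega> = S} =
      Determinant.det E.M * ((- 1) ^ p * Determinant.det (bordered_matrix p L V S))"
    if S: "S \<subseteq> {..<n}" for S
  proof -
    have "(- 1) ^ p * (Determinant.det (bordered_matrix p L V S) * Determinant.det E.M) =
        Determinant.det (choose_rows S K (1\<^sub>m n - K))"
      unfolding E.det_bordered[OF Lc LM S] by (simp add: power_mult_distrib[symmetric] flip: mult.assoc)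
    then show ?thesis using dpp_point_probability[OF assms(4) S] by (simp add: mult_ac)
  qed
  then have "is_extended_L_ensemble n p L V M X"
    using nnp assms(4) pos unfolding is_extended_L_ensemble_def is_dpp_def by blast
  then show ?thesis using nnp by blast
qed

end
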